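(* The following are equivalent: (i) for each $\epsilon>0$ there exists $r_1$ such that if $H=H^*\in B(\ell^2(\mathbb N))$ and $E(H)=0$, then there exists an $r_1$-paving $\{A_1,\dots,A_{r_1}\}$ of $\mathbb N$ such that $\|P_{A_i}HP_{A_i}\|\le\epsilon\|H\|$ for $i=1,\dots,r_1$; (ii) for each $\epsilon>0$ there exists $r_2$ such that if $T\in\mathcal T_0(\mathbb N)$, then there exists an $r_2$-paving $\{A_1,\dots,A_{r_2}\}$ of $\mathbb N$ such that $\|P_{A_i}TP_{A_i}\|\le\epsilon\|T\|$ for $i=1,\dots,r_2$.
   Context: Operators $X\in B(\ell^2(\mathbb N))$ (complex Hilbert space) are identified with their infinite matrices $X=(x_{i,j})$ with respect to the canonical orthonormal basis. $E$ maps $B(\ell^2(\mathbb N))$ onto the diagonal operators by $E((x_{i,j}))=(d_{i,j})$ with $d_{i,i}=x_{i,i}$ and $d_{i,j}=0$ for $i\ne j$. For $A\subseteq\mathbb N$, $P_A$ is the diagonal projection whose $(i,i)$ entry is $1$ if and only if $i\in A$. An $r$-paving of $\mathbb N$ is a finite collection of disjoint subsets $\{A_1,\dots,A_r\}$ with $\mathbb N=A_1\cup\dots\cup A_r$. $\mathcal T_0(\mathbb N)$ is the set of strictly upper triangular operators, i.e. $T=(t_{i,j})\in B(\ell^2(\mathbb N))$ with $t_{i,j}=0$ for all $i\ge j$. *)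

theory Defs
  imports "HOL-Analysis.Analysis"
begin

section \<open>The Hilbert space of square-summable complex sequences\<close>

typedef ell2 = "{x :: nat \<Rightarrow> complex. summable (\<lambda>i. (cmod (x i))\<^sup>2)}"
  morphisms coord Abs_ell2
  by (rule exI[of _ "\<lambda>_. 0"]) simp

setup_lifting type_definition_ell2

lemma ell2_eqI: "(\<And>i. coord x i = coord y i) \<Longrightarrow> x = y"
  by (metis coord_inject ext)

lemma summable_coord: "summable (\<lambda>i. (cmod (coord x i))\<^sup>2)"
  using coord by blast

lemma square_summable_add:
  fixes x y :: "nat \<Rightarrow> complex"
  assumes "summable (\<lambda>i. (cmod (x i))\<^sup>2)" "summable (\<lambda>i. (cmod (y i))\<^sup>2)"
  shows "summable (\<lambda>i. (cmod (x i + y i))\<^sup>2)"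
proof (rule summable_comparison_test')
  show "summable (\<lambda>i. 2 * (cmod (x i))\<^sup>2 + 2 * (cmod (y i))\<^sup>2)"
    by (intro summable_add summable_mult assms)
next
  fix i
  have "(cmod (x i + y i))\<^sup>2 \<le> (cmod (x i) + cmod (y i))\<^sup>2"
    by (intro power_mono norm_triangle_ineq) simp
  also have "\<dots> \<le> 2 * (cmod (x i))\<^sup>2 + 2 * (cmod (y i))\<^sup>2"
    using sum_squares_ge_zero[of "cmod (x i) - cmod (y i)" 0]
    by (simp add: power2_eq_square algebra_simps)
  finally show "norm ((cmod (x i + y i))\<^sup>2) \<le> 2 * (cmod (x i))\<^sup>2 + 2 * (cmod (y i))\<^sup>2"
    by simp
qed

lemma square_summable_mult:
  fixes x d :: "nat \<Rightarrow> complex"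
  assumes "summable (\<lambda>i. (cmod (x i))\<^sup>2)" "\<And>i. cmod (d i) \<le> K"
  shows "summable (\<lambda>i. (cmod (d i * x i))\<^sup>2)"
proof (rule summable_comparison_test')
  show "summable (\<lambda>i. K\<^sup>2 * (cmod (x i))\<^sup>2)"
    by (intro summable_mult assms)
next
  fix i
  have "(cmod (d i))\<^sup>2 \<le> K\<^sup>2"
    using assms(2)[of i] by (intro power_mono) auto
  then show "norm ((cmod (d i * x i))\<^sup>2) \<le> K\<^sup>2 * (cmod (x i))\<^sup>2"
    by (simp add: norm_mult power_mult_distrib mult_right_mono)
qed

lemma summable_norm_cinner:
  "summable (\<lambda>i. cmod (coord x i * cnj (coord y i)))"
proof (rule summable_comparison_test')
  show "summable (\<lambda>i. (cmod (coord x i))\<^sup>2 + (cmod (coord y i))\<^sup>2)"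
    by (intro summable_add summable_coord)
next
  fix i
  show "norm (cmod (coord x i * cnj (coord y i))) \<le> (cmod (coord x i))\<^sup>2 + (cmod (coord y i))\<^sup>2"
    using sum_squares_bound[of "cmod (coord x i)" "cmod (coord y i)"]
      mult_nonneg_nonneg[of "cmod (coord x i)" "cmod (coord y i)"]
    by (simp add: norm_mult del: mult_nonneg_nonneg)
qed

lemmas summable_cinner = summable_norm_cancel[OF summable_norm_cinner]

definition cinner :: "ell2 \<Rightarrow> ell2 \<Rightarrow> complex" where
  "cinner x y = (\<Sum>i. coord x i * cnj (coord y i))"

lift_definition scaleC :: "complex \<Rightarrow> ell2 \<Rightarrow> ell2" is "\<lambda>c x i. c * x i"
  by (rule square_summable_mult[where K = "cmod _"]) auto

lift_definition ket :: "nat \<Rightarrow> ell2" is "\<lambda>j i. if i = j then 1 else 0"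
proof -
  fix j :: nat
  show "summable (\<lambda>i. (cmod (if i = j then 1 else 0))\<^sup>2)"
    by (rule summable_finite[of "{j}"]) auto
qed

text \<open>The norm is \<open>sqrt (\<Sum>i. |x i|\<^sup>2)\<close>; it is obtained from the real inner product
  \<open>Re (cinner x y)\<close>, which makes the type a real inner product space.\<close>

instantiation ell2 :: real_inner
begin

lift_definition zero_ell2 :: ell2 is "\<lambda>_. 0" by simp
lift_definition plus_ell2 :: "ell2 \<Rightarrow> ell2 \<Rightarrow> ell2" is "\<lambda>x y i. x i + y i"
  by (rule square_summable_add)
lift_definition uminus_ell2 :: "ell2 \<Rightarrow> ell2" is "\<lambda>x i. - x i" by simp
lift_definition minus_ell2 :: "ell2 \<Rightarrow> ell2 \<Rightarrow> ell2" is "\<lambda>x y i. x i - y i"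
  using square_summable_add[where y = "\<lambda>i. - (_ i)"] by simp
lift_definition scaleR_ell2 :: "real \<Rightarrow> ell2 \<Rightarrow> ell2" is "\<lambda>r x i. r *\<^sub>R x i"
  unfolding scaleR_conv_of_real by (rule square_summable_mult[where K = "\<bar>_\<bar>"]) auto
definition inner_ell2 :: "ell2 \<Rightarrow> ell2 \<Rightarrow> real" where
  "inner_ell2 x y = Re (cinner x y)"
definition norm_ell2 :: "ell2 \<Rightarrow> real" where
  "norm_ell2 x = sqrt (\<Sum>i. (cmod (coord x i))\<^sup>2)"
definition sgn_ell2 :: "ell2 \<Rightarrow> ell2" where
  "sgn_ell2 x = inverse (norm x) *\<^sub>R x"
definition dist_ell2 :: "ell2 \<Rightarrow> ell2 \<Rightarrow> real" where
  "dist_ell2 x y = norm (x - y)"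
definition uniformity_ell2 :: "(ell2 \<times> ell2) filter" where
  "uniformity_ell2 = (INF e\<in>{0<..}. principal {(x, y). dist x y < e})"
definition open_ell2 :: "ell2 set \<Rightarrow> bool" where
  "open_ell2 U = (\<forall>x\<in>U. eventually (\<lambda>(x', y). x' = x \<longrightarrow> y \<in> U) uniformity)"

lemma inner_ell2_eq: "inner x y = (\<Sum>i. coord x i \<bullet> coord y i)" for x y :: ell2
  unfolding inner_ell2_def cinner_def
  by (subst Re_suminf[OF summable_cinner]) (simp add: inner_complex_def)

lemma summable_inner_ell2: "summable (\<lambda>i. coord x i \<bullet> coord y i)" for x y :: ell2
  using summable_Re[OF summable_cinner[of x y]] by (simp add: inner_complex_def)

instance
proof
  fix x y z :: ell2 and r s :: real
  show "x + y + z = x + (y + z)" "x + y = y + x" "0 + x = x" "- x + x = 0" "x - y = x + - y"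
    "r *\<^sub>R (x + y) = r *\<^sub>R x + r *\<^sub>R y" "(r + s) *\<^sub>R x = r *\<^sub>R x + s *\<^sub>R x"
    "r *\<^sub>R s *\<^sub>R x = (r * s) *\<^sub>R x" "1 *\<^sub>R x = x"
    by (transfer; simp add: algebra_simps)+
  show "dist x y = norm (x - y)" by (rule dist_ell2_def)
  show "sgn x = inverse (norm x) *\<^sub>R x" by (rule sgn_ell2_def)
  show "uniformity = (INF e\<in>{0<..}. principal {(x, y :: ell2). dist x y < e})"
    by (rule uniformity_ell2_def)
  show "open U = (\<forall>x\<in>U. \<forall>\<^sub>F (x', y) in uniformity. x' = x \<longrightarrow> y \<in> U)" for U :: "ell2 set"
    by (rule open_ell2_def)
  show "inner x y = inner y x"
    by (simp add: inner_ell2_eq inner_commute)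
  show "inner (x + y) z = inner x z + inner y z"
    by (simp add: inner_ell2_eq plus_ell2.rep_eq inner_add_left suminf_add summable_inner_ell2)
  show "inner (r *\<^sub>R x) y = r * inner x y"
    by (simp add: inner_ell2_eq scaleR_ell2.rep_eq suminf_mult summable_inner_ell2)
  show "0 \<le> inner x x"
    by (simp add: inner_ell2_eq suminf_nonneg summable_inner_ell2)
  have "(inner x x = 0) = (\<forall>i. coord x i \<bullet> coord x i = 0)"
    unfolding inner_ell2_eq by (rule suminf_eq_zero_iff[OF summable_inner_ell2]) simp
  also have "\<dots> = (x = 0)"
    by transfer auto
  finally show "(inner x x = 0) = (x = 0)" .
  show "norm x = sqrt (inner x x)"
    by (simp add: norm_ell2_def inner_ell2_eq power2_norm_eq_inner)
qed

end

lemmas coord_simps [simp] =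
  zero_ell2.rep_eq plus_ell2.rep_eq uminus_ell2.rep_eq minus_ell2.rep_eq scaleR_ell2.rep_eq
  scaleC.rep_eq ket.rep_eq

lemma norm_ell2_square: "(norm x)\<^sup>2 = (\<Sum>i. (cmod (coord x i))\<^sup>2)" for x :: ell2
  by (simp add: norm_ell2_def suminf_nonneg summable_coord)


section \<open>Bounded operators and their matrices\<close>

text \<open>The library type \<open>ell2 \<Rightarrow>\<^sub>L ell2\<close> consists of the bounded \<^emph>\<open>real\<close>-linear maps, with the
  operator norm. Complex linearity has to be imposed separately.\<close>

definition bounded_ops :: "(ell2 \<Rightarrow>\<^sub>L ell2) set" where
  "bounded_ops = {X. \<forall>c x. blinfun_apply X (scaleC c x) = scaleC c (blinfun_apply X x)}"

definition entry :: "(ell2 \<Rightarrow>\<^sub>L ell2) \<Rightarrow> nat \<Rightarrow> nat \<Rightarrow> complex" where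
  "entry X i j = coord (blinfun_apply X (ket j)) i"

definition adjoint_op :: "(ell2 \<Rightarrow>\<^sub>L ell2) \<Rightarrow> (ell2 \<Rightarrow>\<^sub>L ell2)" where
  "adjoint_op X = (THE Y. Y \<in> bounded_ops \<and>
     (\<forall>x y. cinner (blinfun_apply X x) y = cinner x (blinfun_apply Y y)))"

text \<open>The operator with diagonal matrix \<open>d\<close>; meaningful for bounded \<open>d\<close> only.\<close>

definition diag_op :: "(nat \<Rightarrow> complex) \<Rightarrow> (ell2 \<Rightarrow>\<^sub>L ell2)" where
  "diag_op d = Blinfun (\<lambda>x. Abs_ell2 (\<lambda>i. d i * coord x i))"

definition diag_expectation :: "(ell2 \<Rightarrow>\<^sub>L ell2) \<Rightarrow> (ell2 \<Rightarrow>\<^sub>L ell2)" where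
  "diag_expectation X = diag_op (\<lambda>i. entry X i i)"

definition diag_proj :: "nat set \<Rightarrow> (ell2 \<Rightarrow>\<^sub>L ell2)" where
  "diag_proj A = diag_op (\<lambda>i. if i \<in> A then 1 else 0)"

definition strictly_upper :: "(ell2 \<Rightarrow>\<^sub>L ell2) set" where
  "strictly_upper = {T \<in> bounded_ops. \<forall>i j. j \<le> i \<longrightarrow> entry T i j = 0}"

text \<open>Blocks of a paving may be empty.\<close>

definition paving :: "nat \<Rightarrow> (nat \<Rightarrow> nat set) \<Rightarrow> bool" where
  "paving r A \<longleftrightarrow> disjoint_family_on A {1..r} \<and> (\<Union>i\<in>{1..r}. A i) = UNIV"


section \<open>Well-definedness of the operators above\<close>

lemma cmod_coord_le_norm: "cmod (coord x i) \<le> norm x"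
proof (rule power2_le_imp_le)
  have "(\<Sum>i\<in>{i}. (cmod (coord x i))\<^sup>2) \<le> (\<Sum>i. (cmod (coord x i))\<^sup>2)"
    by (rule sum_le_suminf[OF summable_coord]) auto
  then show "(cmod (coord x i))\<^sup>2 \<le> (norm x)\<^sup>2"
    by (simp add: norm_ell2_square)
qed simp

lemma norm_ket [simp]: "norm (ket j) = 1"
proof -
  have "(\<Sum>i. (cmod (coord (ket j) i))\<^sup>2) = (\<Sum>i\<in>{j}. (cmod (coord (ket j) i))\<^sup>2)"
    by (rule suminf_finite) auto
  then show ?thesis by (simp add: norm_ell2_def)
qed

lemma cmod_entry_le_norm: "cmod (entry X i j) \<le> norm X"
  unfolding entry_def
  using order_trans[OF cmod_coord_le_norm norm_blinfun[of X "ket j"]] by simp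

lemma coord_diag_op:
  assumes "\<And>i. cmod (d i) \<le> K"
  shows "coord (blinfun_apply (diag_op d) x) i = d i * coord x i"
proof -
  define f where "f x = Abs_ell2 (\<lambda>i. d i * coord x i)" for x
  have K: "0 \<le> K" using order_trans[OF norm_ge_zero assms] .
  have f: "coord (f x) i = d i * coord x i" for x i
    unfolding f_def using square_summable_mult[OF summable_coord assms]
    by (subst Abs_ell2_inverse) auto
  have "bounded_linear f"
  proof (rule bounded_linear_intro[where K = K])
    fix x y and r :: real
    show "f (x + y) = f x + f y" "f (r *\<^sub>R x) = r *\<^sub>R f x"
      by (rule ell2_eqI; simp add: f algebra_simps)+
    have "(norm (f x))\<^sup>2 \<le> (\<Sum>i. K\<^sup>2 * (cmod (coord x i))\<^sup>2)"
      unfolding norm_ell2_square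
    proof (rule suminf_le[OF _ summable_coord summable_mult[OF summable_coord]])
      fix i show "(cmod (coord (f x) i))\<^sup>2 \<le> K\<^sup>2 * (cmod (coord x i))\<^sup>2"
        using power_mono[OF assms[of i], of 2]
        by (simp add: f norm_mult power_mult_distrib mult_right_mono)
    qed
    also have "\<dots> = (norm x * K)\<^sup>2"
      by (simp add: suminf_mult summable_coord norm_ell2_square power_mult_distrib)
    finally show "norm (f x) \<le> norm x * K"
      by (rule power2_le_imp_le) (simp add: K)
  qed
  then have "blinfun_apply (diag_op d) = f"
    unfolding diag_op_def f_def by (rule bounded_linear_Blinfun_apply)
  then show ?thesis by (simp add: f)
qed

lemma diag_op_in_bounded_ops:
  assumes "\<And>i. cmod (d i) \<le> K"
  shows "diag_op d \<in> bounded_ops"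
  unfolding bounded_ops_def by (auto intro!: ell2_eqI simp: coord_diag_op[OF assms])

lemma coord_diag_proj:
  "coord (blinfun_apply (diag_proj A) x) i = (if i \<in> A then coord x i else 0)"
  unfolding diag_proj_def by (subst coord_diag_op[where K = 1]) auto

lemma entry_diag_expectation:
  "entry (diag_expectation X) i j = (if i = j then entry X i i else 0)"
  unfolding diag_expectation_def
  by (subst (1) entry_def) (simp add: coord_diag_op[OF cmod_entry_le_norm])

lemma cinner_ket: "cinner x (ket i) = coord x i" "cinner (ket i) x = cnj (coord x i)"
proof -
  have "(\<Sum>k. coord x k * cnj (coord (ket i) k)) = (\<Sum>k\<in>{i}. coord x k * cnj (coord (ket i) k))"
    "(\<Sum>k. coord (ket i) k * cnj (coord x k)) = (\<Sum>k\<in>{i}. coord (ket i) k * cnj (coord x k))"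
    by (rule suminf_finite; simp)+
  then show "cinner x (ket i) = coord x i" "cinner (ket i) x = cnj (coord x i)"
    by (simp_all add: cinner_def)
qed

lemma cinner_add: "cinner (x + y) z = cinner x z + cinner y z" "cinner z (x + y) = cinner z x + cinner z y"
  by (simp_all add: cinner_def algebra_simps suminf_add[OF summable_cinner summable_cinner])

lemma cinner_scaleC: "cinner (scaleC c x) y = c * cinner x y" "cinner x (scaleC c y) = cnj c * cinner x y"
proof -
  show "cinner (scaleC c x) y = c * cinner x y"
    by (simp add: cinner_def mult.assoc suminf_mult[OF summable_cinner])
  have "cinner x (scaleC c y) = (\<Sum>i. cnj c * (coord x i * cnj (coord y i)))"
    by (simp add: cinner_def mult.left_commute)
  then show "cinner x (scaleC c y) = cnj c * cinner x y"
    by (simp only: cinner_def suminf_mult[OF summable_cinner])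
qed

lemma scaleR_ell2_eq_scaleC: "r *\<^sub>R x = scaleC (complex_of_real r) x" for x :: ell2
  by (rule ell2_eqI) (simp add: scaleR_conv_of_real)

lemma norm_scaleC [simp]: "norm (scaleC c x) = cmod c * norm x"
proof (rule power2_eq_imp_eq)
  show "(norm (scaleC c x))\<^sup>2 = (cmod c * norm x)\<^sup>2"
    by (simp add: norm_ell2_square norm_mult power_mult_distrib suminf_mult[OF summable_coord])
qed auto

lemma cinner_bound: "cmod (cinner x y) \<le> norm x * norm y"
proof (cases "cinner x y = 0")
  case False
  define c where "c = cnj (cinner x y) / cmod (cinner x y)"
  have "cmod c = 1" using False by (simp add: c_def norm_divide)
  have "cinner (scaleC c x) y = cmod (cinner x y)"
    using False complex_norm_square[of "cinner x y"]
    by (simp add: cinner_scaleC c_def power2_eq_square field_simps)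
  then have "cmod (cinner x y) = inner (scaleC c x) y"
    by (simp add: inner_ell2_def)
  also have "\<dots> \<le> norm (scaleC c x) * norm y"
    by (rule norm_cauchy_schwarz)
  finally show ?thesis using \<open>cmod c = 1\<close> by simp
qed auto

definition trunc :: "nat \<Rightarrow> (nat \<Rightarrow> complex) \<Rightarrow> ell2" where
  "trunc n a = (\<Sum>i<n. scaleC (a i) (ket i))"

lemma coord_trunc: "coord (trunc n a) i = (if i < n then a i else 0)"
  unfolding trunc_def by (induction n) (auto simp: less_Suc_eq)

lemma norm_trunc_square: "(norm (trunc n a))\<^sup>2 = (\<Sum>i<n. (cmod (a i))\<^sup>2)"
proof -
  have "(\<Sum>i. (cmod (coord (trunc n a) i))\<^sup>2) = (\<Sum>i<n. (cmod (coord (trunc n a) i))\<^sup>2)"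
    by (rule suminf_finite) (auto simp: coord_trunc)
  then show ?thesis by (simp add: norm_ell2_square coord_trunc)
qed

lemma trunc_tendsto: "(\<lambda>n. trunc n (coord x)) \<longlonglongrightarrow> x"
proof -
  have "(norm (x - trunc n (coord x)))\<^sup>2
      = (\<Sum>i. (cmod (coord x i))\<^sup>2) - (\<Sum>i<n. (cmod (coord x i))\<^sup>2)" for n
  proof -
    have "(\<lambda>i. (cmod (coord (x - trunc n (coord x)) i))\<^sup>2)
        = (\<lambda>i. (cmod (coord x i))\<^sup>2 - (cmod (coord (trunc n (coord x)) i))\<^sup>2)"
      by (auto simp: coord_trunc)
    then have "(norm (x - trunc n (coord x)))\<^sup>2 = (norm x)\<^sup>2 - (norm (trunc n (coord x)))\<^sup>2"
      by (simp add: norm_ell2_square suminf_diff[OF summable_coord summable_coord])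
    then show ?thesis
      by (simp add: norm_trunc_square) (simp add: norm_ell2_square)
  qed
  moreover have "(\<lambda>n. (\<Sum>i. (cmod (coord x i))\<^sup>2) - (\<Sum>i<n. (cmod (coord x i))\<^sup>2))
      \<longlonglongrightarrow> (\<Sum>i. (cmod (coord x i))\<^sup>2) - (\<Sum>i. (cmod (coord x i))\<^sup>2)"
    by (intro tendsto_intros summable_LIMSEQ summable_coord)
  ultimately have "(\<lambda>n. (norm (x - trunc n (coord x)))\<^sup>2) \<longlonglongrightarrow> 0"
    by simp
  then have "(\<lambda>n. sqrt ((norm (x - trunc n (coord x)))\<^sup>2)) \<longlonglongrightarrow> sqrt 0"
    by (rule tendsto_real_sqrt)
  then have "(\<lambda>n. norm (trunc n (coord x) - x)) \<longlonglongrightarrow> 0"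
    by (simp add: norm_minus_commute)
  then show ?thesis
    by (rule LIM_zero_cancel[OF tendsto_norm_zero_cancel])
qed

lemma adjoint_exists:
  assumes X: "X \<in> bounded_ops"
  shows "\<exists>Y. Y \<in> bounded_ops \<and>
    (\<forall>x y. cinner (blinfun_apply X x) y = cinner x (blinfun_apply Y y))"
proof -
  define s where "s y i = cinner y (blinfun_apply X (ket i))" for y i
  have fin: "cinner (blinfun_apply X (trunc n a)) y = (\<Sum>i<n. a i * cnj (s y i))" for n a y
  proof (induction n)
    case 0
    show ?case by (simp add: trunc_def cinner_def)
  next
    case (Suc n)
    have "cnj (s y n) = cinner (blinfun_apply X (ket n)) y"
      unfolding s_def cinner_def
      using bounded_linear.suminf[OF bounded_linear_cnj summable_cinner]
      by (simp add: mult.commute)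
    moreover have "trunc (Suc n) a = trunc n a + scaleC (a n) (ket n)"
      by (simp add: trunc_def)
    ultimately show ?case
      using X Suc by (simp add: bounded_ops_def blinfun.add_right cinner_add cinner_scaleC)
  qed
  have bound: "(\<Sum>i<n. (cmod (s y i))\<^sup>2) \<le> (norm X * norm y)\<^sup>2" for n y
  proof -
    let ?v = "trunc n (s y)"
    have "(\<Sum>i<n. s y i * cnj (s y i)) = complex_of_real ((norm ?v)\<^sup>2)"
      unfolding norm_trunc_square by (simp add: complex_norm_square[symmetric])
    then have "cmod (complex_of_real ((norm ?v)\<^sup>2)) \<le> norm (blinfun_apply X ?v) * norm y"
      using cinner_bound[of "blinfun_apply X ?v" y] fin[of n "s y" y] by simp
    also have "\<dots> \<le> norm X * norm ?v * norm y"
      by (intro mult_right_mono norm_blinfun) simp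
    finally have "norm ?v * norm ?v \<le> norm ?v * (norm X * norm y)"
      by (simp add: power2_eq_square norm_mult mult_ac)
    then have "norm ?v \<le> norm X * norm y"
      by (cases "norm ?v = 0") (simp, simp add: mult_le_cancel_left)
    then have "(norm ?v)\<^sup>2 \<le> (norm X * norm y)\<^sup>2"
      by (intro power_mono) auto
    then show ?thesis by (simp add: norm_trunc_square)
  qed
  have sm: "summable (\<lambda>i. (cmod (s y i))\<^sup>2)" for y
    by (rule summableI_nonneg_bounded[OF _ bound]) simp
  define f where "f y = Abs_ell2 (s y)" for y
  have f: "coord (f y) = s y" for y
    unfolding f_def using sm by (subst Abs_ell2_inverse) auto
  have f_scaleC: "f (scaleC c y) = scaleC c (f y)" for c y
    by (rule ell2_eqI) (simp add: f, simp add: s_def cinner_scaleC)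
  have bl: "bounded_linear f"
  proof (rule bounded_linear_intro[where K = "norm X"])
    fix x y and r :: real
    show "f (x + y) = f x + f y"
      by (rule ell2_eqI) (simp add: f, simp add: s_def cinner_add)
    show "f (r *\<^sub>R x) = r *\<^sub>R f x"
      by (simp add: scaleR_ell2_eq_scaleC f_scaleC)
    have "(norm (f x))\<^sup>2 \<le> (norm x * norm X)\<^sup>2"
      using suminf_le_const[OF sm bound] by (simp add: norm_ell2_square f mult.commute)
    then show "norm (f x) \<le> norm x * norm X"
      by (rule power2_le_imp_le) simp
  qed
  have adj: "cinner (blinfun_apply X x) y = cinner x (f y)" for x y
  proof (rule LIMSEQ_unique)
    have "bounded_linear (\<lambda>z. cinner z y)"
      by (rule bounded_linear_intro[where K = "norm y"])
        (simp_all add: cinner_add scaleR_ell2_eq_scaleC cinner_scaleC scaleR_conv_of_real cinner_bound)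
    then show "(\<lambda>n. cinner (blinfun_apply X (trunc n (coord x))) y) \<longlonglongrightarrow> cinner (blinfun_apply X x) y"
      by (rule bounded_linear.tendsto)
        (rule bounded_linear.tendsto[OF blinfun.bounded_linear_right trunc_tendsto])
    show "(\<lambda>n. cinner (blinfun_apply X (trunc n (coord x))) y) \<longlonglongrightarrow> cinner x (f y)"
      using summable_LIMSEQ[OF summable_cinner[of x "f y"]]
      unfolding fin cinner_def[of x "f y"] by (simp add: f)
  qed
  have "blinfun_apply (Blinfun f) = f"
    by (rule bounded_linear_Blinfun_apply[OF bl])
  then show ?thesis
    using f_scaleC adj by (intro exI[of _ "Blinfun f"]) (simp add: bounded_ops_def)
qed

lemma adjoint_unique:
  assumes "\<And>x y. cinner (blinfun_apply X x) y = cinner x (blinfun_apply Y y)"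
    and "\<And>x y. cinner (blinfun_apply X x) y = cinner x (blinfun_apply Z y)"
  shows "Y = Z"
proof (rule blinfun_eqI, rule ell2_eqI)
  fix y i
  have "cinner (ket i) (blinfun_apply Y y) = cinner (ket i) (blinfun_apply Z y)"
    using assms by metis
  then show "coord (blinfun_apply Y y) i = coord (blinfun_apply Z y) i"
    by (simp add: cinner_ket)
qed

lemma adjoint_op:
  assumes "X \<in> bounded_ops"
  shows "adjoint_op X \<in> bounded_ops"
    and "cinner (blinfun_apply X x) y = cinner x (blinfun_apply (adjoint_op X) y)"
proof -
  have "\<exists>!Y. Y \<in> bounded_ops \<and> (\<forall>x y. cinner (blinfun_apply X x) y = cinner x (blinfun_apply Y y))"
    using adjoint_exists[OF assms] adjoint_unique by blast
  from theI'[OF this] show "adjoint_op X \<in> bounded_ops"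
    "cinner (blinfun_apply X x) y = cinner x (blinfun_apply (adjoint_op X) y)"
    unfolding adjoint_op_def by blast+
qed

end

(* From self-adjoint to triangular: split T into real and imaginary parts.

   From triangular to self-adjoint: let K be self-adjoint with zero diagonal and norm at most s.
   A Cholesky factor U of 1 + K is upper triangular, and its diagonal D is 1 + O(s^2) because K has
   zero diagonal. If P_A (U - D) P_A has norm O(s^2), then for x in the range of P_A
     <x, x> + <K x, x> >= |P_A U x|^2 >= (1 - O(s^2)) |x|^2,
   so K >= - O(s^2) on that range. The same for -K on a common refinement gives
   |P_A K P_A| = O(s^2), which beats |K| = s when s is small. *)

theory Submission
  imports Defs
begin

text \<open>The direct converse would write a self-adjoint operator with zero diagonal as T plus its
  adjoint, T being its strictly upper part. The obstacle is that triangular truncation is unbounded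
  on B(l^2), so T need not be a bounded operator. A factor of a positive operator is triangular and
  still bounded, because |U x|^2 is at most the form of the operator at x; in exchange it controls
  that form from one side only.

  The gain rests on homogeneity: the paving bound is relative to the norm, so s may be chosen
  freely. Paving the strictly upper part to size 2 s^2 costs only more blocks, whose number depends
  on s alone. The diagonal also loses at most 2 s^2, and squaring doubles the total of 4 s^2. Hence
  the final bound 8 s^2, which is 8 s relative to norm s and leads to the choice of s at most
  \<epsilon>/8.\<close>

section \<open>Adjoints and matrix entries of complex-linear operators\<close>

lemma cinner_commute: "cinner y x = cnj (cinner x y)"
  unfolding cinner_def bounded_linear.suminf[OF bounded_linear_cnj summable_cinner]
  by (simp add: mult.commute)

lemma cinner_diff:
  "cinner (x - y) z = cinner x z - cinner y z" "cinner z (x - y) = cinner z x - cinner z y"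
  by (simp_all add: cinner_def algebra_simps suminf_diff[OF summable_cinner summable_cinner])

lemma cinner_self: "cinner x x = complex_of_real ((norm x)\<^sup>2)"
proof (rule complex_eqI)
  show "Re (cinner x x) = Re (complex_of_real ((norm x)\<^sup>2))"
    by (simp add: power2_norm_eq_inner inner_ell2_def)
  have "Im (cinner x x) = - Im (cinner x x)"
    using cinner_commute[of x x] by (metis cnj.sel(2))
  then show "Im (cinner x x) = Im (complex_of_real ((norm x)\<^sup>2))"
    by simp
qed

lemma cinner_eq_0_if_disjoint:
  assumes "\<And>i. coord x i = 0 \<or> coord y i = 0"
  shows "cinner x y = 0"
proof -
  have "coord x i * cnj (coord y i) = 0" for i
    using assms[of i] by auto
  then show ?thesis by (simp only: cinner_def suminf_zero)
qed

lemma bounded_ops_scaleC: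
  "X \<in> bounded_ops \<Longrightarrow> blinfun_apply X (scaleC c x) = scaleC c (blinfun_apply X x)"
  by (simp add: bounded_ops_def)

lemma bounded_opsI:
  "(\<And>c x. blinfun_apply X (scaleC c x) = scaleC c (blinfun_apply X x)) \<Longrightarrow> X \<in> bounded_ops"
  by (simp add: bounded_ops_def)

lemma scaleC_add_right: "scaleC c (x + y) = scaleC c x + scaleC c y"
  and scaleC_diff_right: "scaleC c (x - y) = scaleC c x - scaleC c y"
  and scaleC_scaleR: "scaleC c (r *\<^sub>R x) = r *\<^sub>R scaleC c x"
  by (rule ell2_eqI; simp add: algebra_simps)+

lemma bounded_ops_add: "X \<in> bounded_ops \<Longrightarrow> Y \<in> bounded_ops \<Longrightarrow> X + Y \<in> bounded_ops"
  and bounded_ops_diff: "X \<in> bounded_ops \<Longrightarrow> Y \<in> bounded_ops \<Longrightarrow> X - Y \<in> bounded_ops"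
  and bounded_ops_scaleR: "X \<in> bounded_ops \<Longrightarrow> r *\<^sub>R X \<in> bounded_ops"
  and bounded_ops_compose: "X \<in> bounded_ops \<Longrightarrow> Y \<in> bounded_ops \<Longrightarrow> X o\<^sub>L Y \<in> bounded_ops"
  and bounded_ops_id: "id_blinfun \<in> bounded_ops"
  by (simp_all add: bounded_ops_def blinfun.add_left blinfun.diff_left blinfun.scaleR_left
      scaleC_add_right scaleC_diff_right scaleC_scaleR)

lemma adjoint_op_eqI:
  assumes "X \<in> bounded_ops" "\<And>x y. cinner (blinfun_apply X x) y = cinner x (blinfun_apply Y y)"
  shows "adjoint_op X = Y"
  by (rule adjoint_unique[OF adjoint_op(2)[OF assms(1)] assms(2)])

lemma norm_adjoint_op_le:
  assumes "X \<in> bounded_ops"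
  shows "norm (adjoint_op X) \<le> norm X"
proof (rule norm_blinfun_bound)
  fix y
  let ?z = "blinfun_apply (adjoint_op X) y"
  have "(norm ?z)\<^sup>2 = cmod (cinner ?z ?z)"
    by (simp add: cinner_self norm_power)
  also have "\<dots> = cmod (cinner (blinfun_apply X ?z) y)"
    using adjoint_op(2)[OF assms, of ?z y] by simp
  also have "\<dots> \<le> norm (blinfun_apply X ?z) * norm y"
    by (rule cinner_bound)
  also have "\<dots> \<le> norm X * norm ?z * norm y"
    by (intro mult_right_mono norm_blinfun) simp
  finally have "norm ?z * norm ?z \<le> norm ?z * (norm X * norm y)"
    by (simp add: power2_eq_square mult_ac)
  then show "norm ?z \<le> norm X * norm y"
    by (cases "norm ?z = 0") (simp, simp add: mult_le_cancel_left)
qed simp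

lemma entry_adjoint_op:
  assumes "X \<in> bounded_ops"
  shows "entry (adjoint_op X) i j = cnj (entry X j i)"
proof -
  have "cnj (entry X j i) = cnj (cinner (blinfun_apply X (ket i)) (ket j))"
    by (simp add: entry_def cinner_ket)
  also have "\<dots> = cnj (cinner (ket i) (blinfun_apply (adjoint_op X) (ket j)))"
    by (simp add: adjoint_op(2)[OF assms])
  finally show ?thesis by (simp add: entry_def cinner_ket)
qed

text \<open>Equal columns give equality on finite truncations, which are dense. Complex linearity is
  essential: for merely real-linear maps the values at the basis vectors do not fix the values at
  their complex multiples.\<close>

lemma bounded_ops_eqI:
  assumes X: "X \<in> bounded_ops" and Y: "Y \<in> bounded_ops" and eq: "\<And>i j. entry X i j = entry Y i j"
  shows "X = Y"
proof (rule blinfun_eqI)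
  fix x
  have "blinfun_apply X (ket j) = blinfun_apply Y (ket j)" for j
    by (rule ell2_eqI) (use eq in \<open>simp add: entry_def\<close>)
  then have fin: "blinfun_apply X (trunc n a) = blinfun_apply Y (trunc n a)" for n a
    by (simp add: trunc_def blinfun.sum_right bounded_ops_scaleC X Y)
  have "(\<lambda>n. blinfun_apply Z (trunc n (coord x))) \<longlonglongrightarrow> blinfun_apply Z x" for Z :: "ell2 \<Rightarrow>\<^sub>L ell2"
    by (rule bounded_linear.tendsto[OF blinfun.bounded_linear_right trunc_tendsto])
  from LIMSEQ_unique[OF this[of X, unfolded fin] this[of Y]]
  show "blinfun_apply X x = blinfun_apply Y x" .
qed

lemma diag_expectation_eq_0_iff: "diag_expectation X = 0 \<longleftrightarrow> (\<forall>i. entry X i i = 0)"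
proof
  assume "diag_expectation X = 0"
  then have "entry (diag_expectation X) i i = 0" for i
    by (simp add: entry_def)
  then show "\<forall>i. entry X i i = 0" by (simp add: entry_diag_expectation)
next
  assume *: "\<forall>i. entry X i i = 0"
  show "diag_expectation X = 0"
  proof (rule bounded_ops_eqI)
    show "diag_expectation X \<in> bounded_ops"
      unfolding diag_expectation_def by (rule diag_op_in_bounded_ops[OF cmod_entry_le_norm])
    show "0 \<in> bounded_ops"
      by (rule bounded_opsI) (auto intro: ell2_eqI)
    show "entry (diag_expectation X) i j = entry 0 i j" for i j
      unfolding entry_diag_expectation using * by (simp add: entry_def)
  qed
qed

section \<open>Diagonal compressions, refined pavings and the numerical radius\<close>

lemma norm_le_if_coord_le:
  assumes "\<And>i. cmod (coord x i) \<le> cmod (coord y i)"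
  shows "norm x \<le> norm y"
proof (rule power2_le_imp_le)
  show "(norm x)\<^sup>2 \<le> (norm y)\<^sup>2"
    unfolding norm_ell2_square
    by (intro suminf_le summable_coord power_mono assms) auto
qed simp

lemma norm_diag_proj_le: "norm (blinfun_apply (diag_proj A) x) \<le> norm x"
  by (rule norm_le_if_coord_le) (simp add: coord_diag_proj)

lemma norm_diag_op_le:
  assumes "\<And>i. cmod (d i) \<le> K"
  shows "norm (diag_op d) \<le> K"
proof (rule norm_blinfun_bound)
  show K: "0 \<le> K" using order_trans[OF norm_ge_zero assms] .
  fix x
  have "norm (blinfun_apply (diag_op d) x) \<le> norm (scaleC (of_real K) x)"
    by (rule norm_le_if_coord_le)
      (use K in \<open>auto simp: coord_diag_op[OF assms] norm_mult intro!: mult_right_mono assms\<close>)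
  then show "norm (blinfun_apply (diag_op d) x) \<le> K * norm x"
    using K by simp
qed

lemma diag_proj_selfadjoint:
  "cinner (blinfun_apply (diag_proj A) x) y = cinner x (blinfun_apply (diag_proj A) y)"
  unfolding cinner_def by (rule arg_cong[of _ _ suminf]) (auto simp: coord_diag_proj)

lemma diag_proj_Int:
  "blinfun_apply (diag_proj (A \<inter> B)) x = blinfun_apply (diag_proj A) (blinfun_apply (diag_proj B) x)"
  by (rule ell2_eqI) (simp add: coord_diag_proj)

text \<open>The smaller projection absorbs the larger one on both sides, so the smaller compression
  is itself a compression of the larger one. Paving bounds therefore survive refinement.\<close>

lemma compression_mono:
  assumes "B \<subseteq> A"
  shows "norm (diag_proj B o\<^sub>L X o\<^sub>L diag_proj B) \<le> norm (diag_proj A o\<^sub>L X o\<^sub>L diag_proj A)"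
proof (rule norm_blinfun_bound)
  fix x
  let ?C = "diag_proj A o\<^sub>L X o\<^sub>L diag_proj A"
  have "blinfun_apply (diag_proj B o\<^sub>L X o\<^sub>L diag_proj B) x
    = blinfun_apply (diag_proj B) (blinfun_apply ?C (blinfun_apply (diag_proj B) x))"
    using assms by (simp add: diag_proj_Int[symmetric] Int_absorb1 Int_absorb2)
  also have "norm \<dots> \<le> norm (blinfun_apply ?C (blinfun_apply (diag_proj B) x))"
    by (rule norm_diag_proj_le)
  also have "\<dots> \<le> norm ?C * norm (blinfun_apply (diag_proj B) x)"
    by (rule norm_blinfun)
  also have "\<dots> \<le> norm ?C * norm x"
    by (intro mult_left_mono norm_diag_proj_le) simp
  finally show "norm (blinfun_apply (diag_proj B o\<^sub>L X o\<^sub>L diag_proj B) x) \<le> norm ?C * norm x" .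
qed simp

text \<open>Blocks are numbered by an initial segment, so the pairs of indices are renumbered
  through a bijection. Empty intersections are kept as blocks, which makes the number of blocks
  depend on \<open>r\<close> and \<open>s\<close> only.\<close>

lemma paving_refine:
  assumes A: "paving r A" and B: "paving s B"
  obtains C where "paving (r * s) C"
    and "\<And>i. i \<in> {1..r * s} \<Longrightarrow> \<exists>a\<in>{1..r}. \<exists>b\<in>{1..s}. C i = A a \<inter> B b"
proof -
  have "card {1..r * s} = card ({1..r} \<times> {1..s})"
    by (simp add: card_cartesian_product)
  then obtain h where h: "bij_betw h {1..r * s} ({1..r} \<times> {1..s})"
    using finite_same_card_bij[of "{1..r * s}" "{1..r} \<times> {1..s}"] by blast
  define C where "C i = A (fst (h i)) \<inter> B (snd (h i))" for i
  have hin: "h i \<in> {1..r} \<times> {1..s}" if "i \<in> {1..r * s}" for i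
    using bij_betwE[OF h] that by blast
  show ?thesis
  proof
    show "\<exists>a\<in>{1..r}. \<exists>b\<in>{1..s}. C i = A a \<inter> B b" if "i \<in> {1..r * s}" for i
      using hin[OF that] unfolding C_def mem_Times_iff by blast
    show "paving (r * s) C"
      unfolding paving_def
    proof
      show "disjoint_family_on C {1..r * s}"
        unfolding disjoint_family_on_def
      proof (intro ballI impI)
        fix i j assume ij: "i \<in> {1..r * s}" "j \<in> {1..r * s}" "i \<noteq> j"
        then have "h i \<noteq> h j"
          using inj_onD[OF bij_betw_imp_inj_on[OF h]] by blast
        then have "fst (h i) \<noteq> fst (h j) \<or> snd (h i) \<noteq> snd (h j)"
          by (simp add: prod_eq_iff)
        then have "A (fst (h i)) \<inter> A (fst (h j)) = {} \<or> B (snd (h i)) \<inter> B (snd (h j)) = {}"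
          using A B hin[OF ij(1)] hin[OF ij(2)]
          unfolding paving_def disjoint_family_on_def mem_Times_iff by blast
        then show "C i \<inter> C j = {}" unfolding C_def by blast
      qed
      show "(\<Union>i\<in>{1..r * s}. C i) = UNIV"
      proof (rule set_eqI)
        fix x
        have "x \<in> (\<Union>a\<in>{1..r}. A a)" "x \<in> (\<Union>b\<in>{1..s}. B b)"
          using A B by (simp_all only: paving_def UNIV_I)
        then obtain a b where ab: "a \<in> {1..r}" "x \<in> A a" "b \<in> {1..s}" "x \<in> B b"
          by blast
        then have "(a, b) \<in> h ` {1..r * s}"
          unfolding bij_betw_imp_surj_on[OF h] by blast
        then obtain i where i: "i \<in> {1..r * s}" "(a, b) = h i" by (rule imageE)
        have "x \<in> C i"
          unfolding C_def i(2)[symmetric] using ab by simp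
        then show "x \<in> (\<Union>i\<in>{1..r * s}. C i) \<longleftrightarrow> x \<in> UNIV"
          using i(1) by blast
      qed
    qed
  qed
qed

lemma common_paving:
  assumes "paving r A" "\<forall>i\<in>{1..r}. norm (diag_proj (A i) o\<^sub>L X o\<^sub>L diag_proj (A i)) \<le> a"
    and "paving s B" "\<forall>i\<in>{1..s}. norm (diag_proj (B i) o\<^sub>L Y o\<^sub>L diag_proj (B i)) \<le> b"
  obtains C where "paving (r * s) C"
    and "\<And>i. i \<in> {1..r * s} \<Longrightarrow> norm (diag_proj (C i) o\<^sub>L X o\<^sub>L diag_proj (C i)) \<le> a"
    and "\<And>i. i \<in> {1..r * s} \<Longrightarrow> norm (diag_proj (C i) o\<^sub>L Y o\<^sub>L diag_proj (C i)) \<le> b"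
proof -
  obtain C where C: "paving (r * s) C"
    "\<And>i. i \<in> {1..r * s} \<Longrightarrow> \<exists>k\<in>{1..r}. \<exists>l\<in>{1..s}. C i = A k \<inter> B l"
    using paving_refine[OF assms(1,3)] by blast
  have *: "norm (diag_proj (C i) o\<^sub>L X o\<^sub>L diag_proj (C i)) \<le> a \<and>
        norm (diag_proj (C i) o\<^sub>L Y o\<^sub>L diag_proj (C i)) \<le> b" if i: "i \<in> {1..r * s}" for i
  proof -
    obtain k l where kl: "k \<in> {1..r}" "l \<in> {1..s}" "C i = A k \<inter> B l"
      using C(2)[OF i] by blast
    show ?thesis
      unfolding kl(3)
      using order_trans[OF compression_mono[OF Int_lower1] bspec[OF assms(2) kl(1)]]
        order_trans[OF compression_mono[OF Int_lower2] bspec[OF assms(4) kl(2)]]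
      by (rule conjI)
  qed
  show ?thesis by (rule that[OF C(1)]) (use * in blast)+
qed

text \<open>By symmetry, polarization and the parallelogram law turn a bound on the quadratic form
  into one on the mixed form, which is then tested against a multiple of the image of
  \<open>x\<close>.\<close>

lemma norm_le_numerical_radius:
  fixes X :: "ell2 \<Rightarrow>\<^sub>L ell2"
  assumes sym: "\<And>x y. inner (blinfun_apply X x) y = inner x (blinfun_apply X y)"
    and bound: "\<And>x. \<bar>inner (blinfun_apply X x) x\<bar> \<le> c * (norm x)\<^sup>2"
    and c: "0 \<le> c"
  shows "norm X \<le> c"
proof (rule norm_blinfun_bound[OF c])
  fix x
  let ?X = "blinfun_apply X"
  have pol: "2 * inner (?X x) y \<le> c * ((norm x)\<^sup>2 + (norm y)\<^sup>2)" for y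
  proof -
    have "4 * inner (?X x) y = inner (?X (x + y)) (x + y) - inner (?X (x - y)) (x - y)"
      using sym[of x y] sym[of y x]
      by (simp add: blinfun.add_right blinfun.diff_right inner_add inner_diff inner_commute)
    also have "\<dots> \<le> c * (norm (x + y))\<^sup>2 + c * (norm (x - y))\<^sup>2"
      using bound[of "x + y"] bound[of "x - y"] by linarith
    also have "\<dots> = 2 * (c * ((norm x)\<^sup>2 + (norm y)\<^sup>2))"
      by (simp add: power2_norm_eq_inner inner_add inner_diff inner_commute algebra_simps)
    finally show ?thesis by simp
  qed
  show "norm (?X x) \<le> c * norm x"
  proof (cases "?X x = 0")
    case False
    \<comment> \<open>This scaling gives the test vector the norm of \<open>x\<close>, so that both
      squares on the right of \<open>pol\<close> coincide.\<close>
    define t where "t = norm x / norm (?X x)"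
    have "2 * (t * (norm (?X x))\<^sup>2) \<le> c * ((norm x)\<^sup>2 + (norm (t *\<^sub>R ?X x))\<^sup>2)"
      using pol[of "t *\<^sub>R ?X x"] by (simp add: power2_norm_eq_inner)
    also have "norm (t *\<^sub>R ?X x) = norm x"
      using False by (simp add: t_def)
    also have "t * (norm (?X x))\<^sup>2 = norm x * norm (?X x)"
      using False by (simp add: t_def power2_eq_square)
    finally have "norm x * norm (?X x) \<le> norm x * (c * norm x)"
      by (simp add: power2_eq_square algebra_simps)
    moreover have "norm x \<noteq> 0" using False by auto
    ultimately show ?thesis by (simp add: mult_le_cancel_left)
  qed (simp add: c)
qed

section \<open>Triangular factors of positive operators by Gram-Schmidt\<close>

text \<open>Here \<open>y\<close> projects \<open>z\<close> onto the first \<open>n\<close> basis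
  vectors along the form of \<open>P\<close>: the vanishing coordinates say that
  \<open>P (z - y)\<close> is orthogonal to each of them. The induction needs \<open>z\<close>
  arbitrary, since its hypothesis is used for \<open>z\<close> and for the new basis vector.\<close>

lemma exists_orthogonal_projection:
  fixes P :: "ell2 \<Rightarrow>\<^sub>L ell2"
  assumes P: "P \<in> bounded_ops"
    and pos: "\<And>x. x \<noteq> 0 \<Longrightarrow> cinner (blinfun_apply P x) x \<noteq> 0"
  shows "\<exists>y. (\<forall>i\<ge>n. coord y i = 0) \<and> (\<forall>j<n. coord (blinfun_apply P (z - y)) j = 0)"
proof (induction n arbitrary: z)
  case 0
  show ?case by (rule exI[of _ 0]) simp
next
  case (Suc n)
  obtain y where y: "\<forall>i\<ge>n. coord y i = 0" "\<forall>j<n. coord (blinfun_apply P (z - y)) j = 0"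
    using Suc.IH by blast
  obtain w where w: "\<forall>i\<ge>n. coord w i = 0" "\<forall>j<n. coord (blinfun_apply P (ket n - w)) j = 0"
    using Suc.IH by blast
  define v where "v = ket n - w"
  have "coord v n = 1" using w by (simp add: v_def)
  then have "v \<noteq> 0" by auto
  \<comment> \<open>\<open>P v\<close> vanishes below \<open>n\<close> and \<open>w\<close> from
    \<open>n\<close> on. Thus the pivot, coordinate \<open>n\<close> of \<open>P v\<close>, is the
    form at \<open>v\<close> and cannot be zero.\<close>
  have "cinner (blinfun_apply P v) w = 0"
    by (rule cinner_eq_0_if_disjoint) (use w in \<open>auto simp: v_def not_le[symmetric]\<close>)
  then have "cinner (blinfun_apply P v) (ket n - w) = coord (blinfun_apply P v) n"
    by (simp add: cinner_diff cinner_ket)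
  then have "coord (blinfun_apply P v) n = cinner (blinfun_apply P v) v"
    by (simp add: v_def)
  then have nz: "coord (blinfun_apply P v) n \<noteq> 0" using pos[OF \<open>v \<noteq> 0\<close>] by simp
  \<comment> \<open>Subtracting \<open>c\<close> times \<open>v\<close> cancels coordinate
    \<open>n\<close> and leaves the lower ones at zero, because those of \<open>P v\<close> already
    vanish.\<close>
  define c where "c = coord (blinfun_apply P (z - y)) n / coord (blinfun_apply P v) n"
  have *: "coord (blinfun_apply P (z - (y + scaleC c v))) j
      = coord (blinfun_apply P (z - y)) j - c * coord (blinfun_apply P v) j" for j
    by (simp add: blinfun.diff_right blinfun.add_right bounded_ops_scaleC[OF P])
  show ?case
  proof (intro exI conjI allI impI)
    show "coord (y + scaleC c v) i = 0" if "Suc n \<le> i" for i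
      using that y(1) w(1) by (simp add: v_def)
    show "coord (blinfun_apply P (z - (y + scaleC c v))) j = 0" if "j < Suc n" for j
      unfolding * using that y(2) w(2) nz by (auto simp: less_Suc_eq c_def v_def[symmetric])
  qed
qed

text \<open>Row \<open>k\<close> of \<open>U\<close> is \<open>x \<mapsto> \<langle>P x, q\<^sub>k\<rangle>\<close>, where \<open>q\<^sub>k\<close> is the Gram-Schmidt orthonormalization
  of the basis with respect to \<open>\<langle>P x, y\<rangle>\<close>. In fact \<open>U\<^sup>* U = P\<close>, but Bessel's inequality
  is all that is needed.\<close>

lemma exists_upper_triangular_minorant:
  fixes P :: "ell2 \<Rightarrow>\<^sub>L ell2"
  assumes P: "P \<in> bounded_ops"
    and sym: "\<And>x y. cinner (blinfun_apply P x) y = cinner x (blinfun_apply P y)"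
    and pos: "\<And>x. x \<noteq> 0 \<Longrightarrow> 0 < inner (blinfun_apply P x) x"
  obtains U where "U \<in> bounded_ops"
    and "\<And>x. (norm (blinfun_apply U x))\<^sup>2 \<le> inner (blinfun_apply P x) x"
    and "\<And>i j. j < i \<Longrightarrow> entry U i j = 0"
    and "\<And>k. \<exists>v. coord v k = 1 \<and> (\<forall>i>k. coord v i = 0) \<and>
           entry U k k = complex_of_real (sqrt (inner (blinfun_apply P v) v))"
proof -
  have real: "cinner (blinfun_apply P x) x = complex_of_real (inner (blinfun_apply P x) x)" for x
  proof -
    have "cnj (cinner (blinfun_apply P x) x) = cinner (blinfun_apply P x) x"
      using sym[of x x] cinner_commute[of x "blinfun_apply P x"] by simp
    then show ?thesis by (simp add: inner_ell2_def complex_eq_iff)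
  qed
  have pos': "cinner (blinfun_apply P x) x \<noteq> 0" if "x \<noteq> 0" for x
    using pos[OF that] by (simp add: real)
  \<comment> \<open>Opposite supports drive the construction: \<open>v\<close> lives on indices up
    to \<open>k\<close>, its image under \<open>P\<close> on indices from \<open>k\<close> on.
    Orthogonality and triangularity both follow from this.\<close>
  have "\<exists>v. coord v k = 1 \<and> (\<forall>i>k. coord v i = 0) \<and> (\<forall>j<k. coord (blinfun_apply P v) j = 0)" for k
  proof -
    obtain y where "\<forall>i\<ge>k. coord y i = 0" "\<forall>j<k. coord (blinfun_apply P (ket k - y)) j = 0"
      using exists_orthogonal_projection[OF P pos'] by blast
    then show ?thesis by (intro exI[of _ "ket k - y"]) auto
  qed
  then obtain v where v1: "coord (v k) k = 1" and v0: "\<And>i. k < i \<Longrightarrow> coord (v k) i = 0"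
    and Pv: "\<And>j. j < k \<Longrightarrow> coord (blinfun_apply P (v k)) j = 0" for k
    by metis
  define g where "g k = inner (blinfun_apply P (v k)) (v k)" for k
  have g: "0 < g k" for k
  proof -
    have "v k \<noteq> 0" using v1[of k] by auto
    then show ?thesis unfolding g_def by (rule pos)
  qed
  have Pvk: "coord (blinfun_apply P (v k)) k = complex_of_real (g k)" for k
  proof -
    \<comment> \<open>\<open>v k - ket k\<close> lives strictly below \<open>k\<close>, where the
      image of \<open>v k\<close> vanishes; so the pivot equals \<open>g k\<close>.\<close>
    have "cinner (blinfun_apply P (v k)) (v k - ket k) = 0"
    proof (rule cinner_eq_0_if_disjoint)
      fix i show "coord (blinfun_apply P (v k)) i = 0 \<or> coord (v k - ket k) i = 0"
        using Pv[of i k] v0[of k i] v1[of k] by (cases i k rule: linorder_cases) auto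
    qed
    then show ?thesis
      by (simp add: cinner_diff cinner_ket g_def real)
  qed
  define q where "q k = scaleC (complex_of_real (1 / sqrt (g k))) (v k)" for k
  have Pq: "blinfun_apply P (q k) = scaleC (complex_of_real (1 / sqrt (g k))) (blinfun_apply P (v k))" for k
    by (simp add: q_def bounded_ops_scaleC[OF P])
  have Pqq: "cinner (blinfun_apply P (q k)) (q k) = 1" for k
  proof -
    have "complex_of_real (1 / sqrt (g k)) * (complex_of_real (1 / sqrt (g k)) * complex_of_real (g k)) = 1"
      using g[of k] by (simp flip: of_real_mult add: field_simps)
    then show ?thesis
      by (simp add: Pq) (simp add: q_def cinner_scaleC g_def real)
  qed
  have orth: "cinner (blinfun_apply P (q n)) (q k) = 0" if "k < n" for n k
  proof (rule cinner_eq_0_if_disjoint)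
    fix i show "coord (blinfun_apply P (q n)) i = 0 \<or> coord (q k) i = 0"
    proof (cases "i < n")
      case True
      then show ?thesis by (simp add: Pq Pv)
    next
      case False
      then show ?thesis using that by (simp add: q_def v0)
    qed
  qed
  have c_q: "cinner (blinfun_apply P (x - scaleC c (q n))) z
      = cinner (blinfun_apply P x) z - c * cinner (blinfun_apply P (q n)) z" for x c n z
    by (simp add: blinfun.diff_right bounded_ops_scaleC[OF P] cinner_diff cinner_scaleC)
  define s where "s x k = cinner (blinfun_apply P x) (q k)" for x k
  \<comment> \<open>The induction removes from \<open>x\<close> its component along the last vector.
    Orthogonality keeps the earlier coefficients unchanged, and the form drops by exactly the square
    of the removed coefficient.\<close>
  have bessel: "(\<Sum>k<n. (cmod (s x k))\<^sup>2) \<le> inner (blinfun_apply P x) x" for x n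
  proof (induction n arbitrary: x)
    case 0
    show ?case using pos[of x] by (cases "x = 0") auto
  next
    case (Suc n)
    let ?x = "x - scaleC (s x n) (q n)"
    have "s ?x k = s x k" if "k < n" for k
      using orth[OF that] by (simp add: s_def c_q)
    then have "(\<Sum>k<n. (cmod (s x k))\<^sup>2) \<le> inner (blinfun_apply P ?x) ?x"
      using Suc.IH[of ?x] by simp
    moreover have "cinner (blinfun_apply P ?x) ?x = cinner (blinfun_apply P x) x - (cmod (s x n))\<^sup>2"
    proof -
      have 1: "cinner (blinfun_apply P (q n)) x = cnj (s x n)"
        using cinner_commute[of "blinfun_apply P (q n)" x] sym[of x "q n"]
        by (metis s_def cinner_commute)
      have 2: "cinner (blinfun_apply P ?x) (q n) = 0"
        by (simp add: c_q Pqq) (simp add: s_def)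
      have "cinner (blinfun_apply P ?x) ?x = cinner (blinfun_apply P ?x) x"
        using cinner_diff(2)[of "blinfun_apply P ?x" x "scaleC (s x n) (q n)"]
        by (simp only: 2 cinner_scaleC mult_zero_right diff_zero)
      also have "\<dots> = cinner (blinfun_apply P x) x - s x n * cnj (s x n)"
        by (simp only: c_q 1)
      finally show ?thesis
        by (simp only: complex_norm_square[symmetric])
    qed
    then have "inner (blinfun_apply P ?x) ?x = inner (blinfun_apply P x) x - (cmod (s x n))\<^sup>2"
      by (simp add: inner_ell2_def)
    ultimately show ?case by simp
  qed
  have sm: "summable (\<lambda>k. (cmod (s x k))\<^sup>2)" for x
    by (rule summableI_nonneg_bounded[OF _ bessel]) simp
  define f where "f x = Abs_ell2 (s x)" for x
  have f: "coord (f x) = s x" for x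
    unfolding f_def using sm by (subst Abs_ell2_inverse) auto
  have f_bound: "(norm (f x))\<^sup>2 \<le> inner (blinfun_apply P x) x" for x
    using suminf_le_const[OF sm bessel] by (simp add: norm_ell2_square f)
  have f_scaleC: "f (scaleC c x) = scaleC c (f x)" for c x
    by (rule ell2_eqI) (simp add: f, simp add: s_def bounded_ops_scaleC[OF P] cinner_scaleC)
  have "bounded_linear f"
  proof (rule bounded_linear_intro[where K = "sqrt (norm P)"])
    fix x y and r :: real
    show "f (x + y) = f x + f y"
      by (rule ell2_eqI) (simp add: f, simp add: s_def blinfun.add_right cinner_add)
    show "f (r *\<^sub>R x) = r *\<^sub>R f x"
      by (simp add: scaleR_ell2_eq_scaleC f_scaleC)
    have "inner (blinfun_apply P x) x \<le> norm (blinfun_apply P x) * norm x"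
      by (rule norm_cauchy_schwarz)
    also have "\<dots> \<le> norm P * norm x * norm x"
      by (intro mult_right_mono norm_blinfun) simp
    finally have "(norm (f x))\<^sup>2 \<le> (norm x * sqrt (norm P))\<^sup>2"
      using f_bound[of x] by (simp add: power_mult_distrib power2_eq_square mult_ac)
    then show "norm (f x) \<le> norm x * sqrt (norm P)"
      by (rule power2_le_imp_le) simp
  qed
  then have U: "blinfun_apply (Blinfun f) = f"
    by (rule bounded_linear_Blinfun_apply)
  \<comment> \<open>Symmetry moves \<open>P\<close> onto \<open>q i\<close>, so row \<open>i\<close>
    is the conjugate of the image of \<open>q i\<close> and inherits its zeros to the left of the
    diagonal.\<close>
  have entry: "entry (Blinfun f) i j = cnj (coord (blinfun_apply P (q i)) j)" for i j
    using sym[of "ket j" "q i"] by (simp add: entry_def U f s_def cinner_ket)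
  show ?thesis
  proof
    show "Blinfun f \<in> bounded_ops"
      by (rule bounded_opsI) (simp add: U f_scaleC)
    show "(norm (blinfun_apply (Blinfun f) x))\<^sup>2 \<le> inner (blinfun_apply P x) x" for x
      by (simp add: U f_bound)
    show "entry (Blinfun f) i j = 0" if "j < i" for i j
      by (simp add: entry Pq Pv[OF that])
    show "\<exists>w. coord w k = 1 \<and> (\<forall>i>k. coord w i = 0) \<and>
           entry (Blinfun f) k k = complex_of_real (sqrt (inner (blinfun_apply P w) w))" for k
    \<comment> \<open>The witness is the vector before normalization: its coordinate 1 at
      \<open>k\<close> is what the later lower bound on the diagonal starts from.\<close>
    proof (intro exI[of _ "v k"] conjI allI impI)
      have "1 / sqrt (g k) * g k = sqrt (g k)"
        using g[of k] by (simp add: field_simps)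
      then show "entry (Blinfun f) k k = complex_of_real (sqrt (inner (blinfun_apply P (v k)) (v k)))"
        unfolding entry Pq g_def[symmetric] by (simp add: Pvk flip: of_real_mult of_real_divide)
    qed (auto simp: v1 v0)
  qed
qed

section \<open>Triangular factors of small perturbations of the identity\<close>

lemma inner_selfadjoint:
  assumes "X \<in> bounded_ops" "X = adjoint_op X"
  shows "cinner (blinfun_apply X x) y = cinner x (blinfun_apply X y)"
    and "inner (blinfun_apply X x) y = inner x (blinfun_apply X y)"
  using adjoint_op(2)[OF assms(1), of x y] assms(2) by (simp_all add: inner_ell2_def)

lemma abs_inner_blinfun_le:
  fixes X :: "'a::real_inner \<Rightarrow>\<^sub>L 'a"
  shows "\<bar>inner (blinfun_apply X x) y\<bar> \<le> norm X * norm x * norm y"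
  using Cauchy_Schwarz_ineq2[of "blinfun_apply X x" y]
    mult_right_mono[OF norm_blinfun[of X x], of "norm y"] by simp

lemma adjoint_op_scaleR:
  assumes "X \<in> bounded_ops" "X = adjoint_op X"
  shows "r *\<^sub>R X = adjoint_op (r *\<^sub>R X)"
  by (rule adjoint_op_eqI[OF bounded_ops_scaleR[OF assms(1)], symmetric])
    (simp add: blinfun.scaleR_left scaleR_ell2_eq_scaleC cinner_scaleC inner_selfadjoint(1)[OF assms])

lemma entry_scaleR: "entry (r *\<^sub>R X) i j = r *\<^sub>R entry X i j"
  by (simp add: entry_def blinfun.scaleR_left)

text \<open>Split off the basis vector: \<open>v\<close> is \<open>ket k\<close> plus an orthogonal
  \<open>w\<close>. The zero diagonal removes the first-order term at \<open>ket k\<close>, so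
  \<open>K\<close> acts to first order only through the cross term, at most 2 s |w| in size. What
  remains of |w|^2 after the form at \<open>w\<close> takes at most half absorbs it at a cost of
  second order in \<open>s\<close>.\<close>

lemma inner_ge_if_coord_1:
  fixes K :: "ell2 \<Rightarrow>\<^sub>L ell2"
  assumes K: "K \<in> bounded_ops" "K = adjoint_op K" "entry K k k = 0"
    and s: "norm K \<le> s" "s \<le> 1/2"
    and v: "coord v k = 1"
  shows "1 - 2 * s\<^sup>2 \<le> (norm v)\<^sup>2 + inner (blinfun_apply K v) v"
proof -
  define w where "w = v - ket k"
  have v_eq: "v = ket k + w" by (simp add: w_def)
  let ?t = "norm w"
  have ew: "inner (ket k) w = 0"
    by (simp add: inner_ell2_def cinner_ket w_def v)
  have "inner (blinfun_apply K (ket k)) (ket k) = 0"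
    using K(3) by (simp add: inner_ell2_def cinner_ket entry_def)
  then have "inner (blinfun_apply K v) v
      = 2 * inner (blinfun_apply K (ket k)) w + inner (blinfun_apply K w) w"
    using inner_selfadjoint(2)[OF K(1,2), of w "ket k"]
    by (simp add: v_eq blinfun.add_right inner_add inner_commute)
  moreover have "(norm v)\<^sup>2 = 1 + ?t\<^sup>2"
    using ew norm_ket[of k] unfolding v_eq power2_norm_eq_inner norm_eq_sqrt_inner[of "ket k"]
    by (simp add: inner_add inner_commute)
  moreover have "\<bar>inner (blinfun_apply K (ket k)) w\<bar> \<le> s * ?t"
    using abs_inner_blinfun_le[of K "ket k" w] mult_right_mono[OF s(1), of ?t] by simp
  moreover have "\<bar>inner (blinfun_apply K w) w\<bar> \<le> ?t\<^sup>2 / 2"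
  proof -
    have "norm K * (?t * ?t) \<le> 1/2 * (?t * ?t)"
      by (rule mult_right_mono) (use s in auto)
    then show ?thesis
      using abs_inner_blinfun_le[of K w w] by (simp add: power2_eq_square mult.assoc)
  qed
  \<comment> \<open>Completing the square: t^2/2 - 2 s t is smallest at t = 2 s, with value -2
    s^2.\<close>
  moreover have "0 \<le> (?t - 2 * s)\<^sup>2" by simp
  then have "2 * s * ?t - 2 * s\<^sup>2 \<le> ?t\<^sup>2 / 2"
    by (simp add: power2_eq_square algebra_simps)
  ultimately show ?thesis by linarith
qed

text \<open>The bound 1/2 on \<open>K\<close> keeps the form of the identity plus \<open>K\<close>
  between 1/2 and 3/2 of the squared norm, so a triangular minorant exists with norm at most 2. Its
  diagonal entries obey the same bound, whence 4 for the strictly upper rest. The diagonal is kept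
  apart because paving can shrink only that rest.\<close>

lemma exists_triangular_factor:
  fixes K :: "ell2 \<Rightarrow>\<^sub>L ell2"
  assumes K: "K \<in> bounded_ops" "K = adjoint_op K" "\<And>i. entry K i i = 0"
    and s: "norm K \<le> s" "s \<le> 1/2"
  obtains T D where "T \<in> strictly_upper" "norm T \<le> 4"
    and "\<And>k. 1 - 2 * s\<^sup>2 \<le> D k" "\<And>k. D k \<le> (2::real)"
    and "\<And>x. (norm (blinfun_apply (T + diag_op (\<lambda>k. complex_of_real (D k))) x))\<^sup>2
          \<le> (norm x)\<^sup>2 + inner (blinfun_apply K x) x"
proof -
  define P where "P = id_blinfun + K"
  have s0: "0 \<le> s" using order_trans[OF norm_ge_zero s(1)] .
  have inner_P: "inner (blinfun_apply P x) x = (norm x)\<^sup>2 + inner (blinfun_apply K x) x" for x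
    by (simp add: P_def blinfun.add_left inner_add power2_norm_eq_inner)
  have K_le: "\<bar>inner (blinfun_apply K x) x\<bar> \<le> (norm x)\<^sup>2 / 2" for x
  proof -
    have "norm K * (norm x * norm x) \<le> 1/2 * (norm x * norm x)"
      by (rule mult_right_mono) (use s in auto)
    then show ?thesis
      using abs_inner_blinfun_le[of K x x] by (simp add: power2_eq_square mult.assoc)
  qed
  have P: "P \<in> bounded_ops"
    unfolding P_def by (intro bounded_ops_add bounded_ops_id K)
  have sym: "cinner (blinfun_apply P x) y = cinner x (blinfun_apply P y)" for x y
    by (simp add: P_def blinfun.add_left cinner_add inner_selfadjoint(1)[OF K(1,2)])
  have pos: "0 < inner (blinfun_apply P x) x" if "x \<noteq> 0" for x
  proof -
    have "0 < (norm x)\<^sup>2" using that by simp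
    then show ?thesis using K_le[of x] unfolding inner_P by linarith
  qed
  obtain U where U: "U \<in> bounded_ops"
    and U_le: "\<And>x. (norm (blinfun_apply U x))\<^sup>2 \<le> inner (blinfun_apply P x) x"
    and U_upper: "\<And>i j. j < i \<Longrightarrow> entry U i j = 0"
    and U_diag: "\<And>k. \<exists>v. coord v k = 1 \<and> (\<forall>i>k. coord v i = 0) \<and>
           entry U k k = complex_of_real (sqrt (inner (blinfun_apply P v) v))"
    using exists_upper_triangular_minorant[OF P sym pos] by blast
  have normU: "norm U \<le> 2"
  proof (rule norm_blinfun_bound)
    fix x
    have "(norm (blinfun_apply U x))\<^sup>2 \<le> (2 * norm x)\<^sup>2"
      using U_le[of x] K_le[of x] zero_le_power2[of "norm x"]
      unfolding inner_P by (simp add: power_mult_distrib)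
    then show "norm (blinfun_apply U x) \<le> 2 * norm x"
      by (rule power2_le_imp_le) simp
  qed simp
  define D where "D k = Re (entry U k k)" for k
  have D: "entry U k k = complex_of_real (D k)" for k
    using U_diag[of k] by (auto simp: D_def)
  have D_ge: "1 - 2 * s\<^sup>2 \<le> D k" for k
  proof -
    obtain v where v: "coord v k = 1"
      "entry U k k = complex_of_real (sqrt (inner (blinfun_apply P v) v))"
      using U_diag[of k] by blast
    have "s\<^sup>2 \<le> (1/2)\<^sup>2" using s s0 by (intro power_mono)
    then have 0: "0 \<le> 1 - 2 * s\<^sup>2" by (simp add: power2_eq_square)
    \<comment> \<open>The diagonal entry is a square root, and a number in [0, 1] is at most its
      square root, so the lower bound passes through unchanged.\<close>
    have "(1 - 2 * s\<^sup>2)\<^sup>2 \<le> 1 - 2 * s\<^sup>2"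
      unfolding power2_eq_square[of "1 - 2 * s\<^sup>2"] by (rule mult_left_le) (use 0 in auto)
    also have "\<dots> \<le> inner (blinfun_apply P v) v"
      unfolding inner_P by (rule inner_ge_if_coord_1[OF K s v(1)])
    finally have "1 - 2 * s\<^sup>2 \<le> sqrt (inner (blinfun_apply P v) v)"
      by (rule real_le_rsqrt)
    then show ?thesis using v(2) by (simp add: D_def)
  qed
  have cmod_D: "cmod (complex_of_real (D k)) \<le> 2" for k
    using order_trans[OF cmod_entry_le_norm normU, of k k] by (simp add: D)
  have D_le: "D k \<le> 2" for k using cmod_D[of k] by simp
  let ?D = "diag_op (\<lambda>k. complex_of_real (D k))"
  have entry_D: "entry ?D i j = (if i = j then complex_of_real (D i) else 0)" for i j
    by (simp add: entry_def coord_diag_op[OF cmod_D])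
  show ?thesis
  proof
    have "entry (U - ?D) i j = 0" if "j \<le> i" for i j
      using that U_upper[of j i] D[of i] entry_D[of i j]
      by (cases "j = i") (auto simp: entry_def blinfun.diff_left)
    then show "U - ?D \<in> strictly_upper"
      using bounded_ops_diff[OF U diag_op_in_bounded_ops[OF cmod_D]]
      by (simp add: strictly_upper_def)
    show "norm (U - ?D) \<le> 4"
      using norm_triangle_ineq4[of U ?D] normU norm_diag_op_le[of "\<lambda>k. complex_of_real (D k)", OF cmod_D]
      by linarith
    show "(norm (blinfun_apply (U - ?D + ?D) x))\<^sup>2 \<le> (norm x)\<^sup>2 + inner (blinfun_apply K x) x" for x
      using U_le[of x] by (simp add: inner_P)
  qed (rule D_ge D_le)+
qed

text \<open>A diagonal operator preserves the range of the projection, so there it shrinks norms by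
  a factor no smaller than 1 - 2 s^2. The compressed \<open>T\<close> takes away at most another 2
  s^2, leaving 1 - 4 s^2 to be squared.\<close>

lemma inner_compression_ge:
  fixes K T :: "ell2 \<Rightarrow>\<^sub>L ell2" and D :: "nat \<Rightarrow> real"
  assumes D: "\<And>k. 1 - 2 * s\<^sup>2 \<le> D k" "\<And>k. D k \<le> C"
    and TD: "\<And>x. (norm (blinfun_apply (T + diag_op (\<lambda>k. complex_of_real (D k))) x))\<^sup>2
          \<le> (norm x)\<^sup>2 + inner (blinfun_apply K x) x"
    and s: "0 \<le> s" "s \<le> 1/2"
    and T: "norm (diag_proj A o\<^sub>L T o\<^sub>L diag_proj A) \<le> 2 * s\<^sup>2"
  shows "- (8 * s\<^sup>2 * (norm x)\<^sup>2)
    \<le> inner (blinfun_apply K (blinfun_apply (diag_proj A) x)) (blinfun_apply (diag_proj A) x)"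
proof -
  let ?P = "blinfun_apply (diag_proj A)"
  let ?d = "\<lambda>k. complex_of_real (D k)"
  let ?U = "T + diag_op ?d"
  define y where "y = ?P x"
  have Py: "?P y = y" by (simp add: y_def diag_proj_Int[symmetric])
  have "s\<^sup>2 \<le> (1/2)\<^sup>2" using s by (intro power_mono)
  then have s2: "4 * s\<^sup>2 \<le> 1" by (simp add: power2_eq_square)
  have D0: "0 \<le> D k" for k using D(1)[of k] s2 zero_le_power2[of s] by linarith
  have cmod_D: "cmod (?d k) \<le> C" for k using D(2)[of k] D0[of k] by simp
  have "norm (scaleC (of_real (1 - 2 * s\<^sup>2)) y) \<le> norm (?P (blinfun_apply (diag_op ?d) y))"
  proof (rule norm_le_if_coord_le)
    fix k
    have "\<bar>1 - 2 * s\<^sup>2\<bar> * cmod (coord y k) \<le> \<bar>D k\<bar> * cmod (coord y k)"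
      using D(1)[of k] D0[of k] s2 zero_le_power2[of s] by (intro mult_right_mono) auto
    moreover have "coord y k = 0" if "k \<notin> A"
      using that by (simp add: y_def coord_diag_proj)
    ultimately show "cmod (coord (scaleC (of_real (1 - 2 * s\<^sup>2)) y) k)
        \<le> cmod (coord (?P (blinfun_apply (diag_op ?d) y)) k)"
      by (simp add: coord_diag_proj coord_diag_op[OF cmod_D] norm_mult del: of_real_diff)
  qed
  then have "(1 - 2 * s\<^sup>2) * norm y \<le> norm (?P (blinfun_apply (diag_op ?d) y))"
    using s2 zero_le_power2[of s] by (simp del: of_real_diff)
  also have "?P (blinfun_apply (diag_op ?d) y) = ?P (blinfun_apply ?U y) - ?P (blinfun_apply T y)"
    by (simp add: blinfun.add_left blinfun.add_right)
  also have "norm \<dots> \<le> norm (?P (blinfun_apply ?U y)) + norm (?P (blinfun_apply T y))"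
    by (rule norm_triangle_ineq4)
  also have "norm (?P (blinfun_apply ?U y)) \<le> norm (blinfun_apply ?U y)"
    by (rule norm_diag_proj_le)
  also have "norm (?P (blinfun_apply T y)) \<le> 2 * s\<^sup>2 * norm y"
    using order_trans[OF norm_blinfun[of "diag_proj A o\<^sub>L T o\<^sub>L diag_proj A" y]
        mult_right_mono[OF T norm_ge_zero[of y]]]
    by (simp add: Py)
  finally have "(1 - 4 * s\<^sup>2) * norm y \<le> norm (blinfun_apply ?U y)"
    by (simp add: algebra_simps)
  then have "((1 - 4 * s\<^sup>2) * norm y)\<^sup>2 \<le> (norm (blinfun_apply ?U y))\<^sup>2"
    using s2 by (intro power_mono mult_nonneg_nonneg) auto
  also have "\<dots> \<le> (norm y)\<^sup>2 + inner (blinfun_apply K y) y" by (rule TD)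
  finally have "(1 - 4 * s\<^sup>2)\<^sup>2 * (norm y)\<^sup>2 \<le> (norm y)\<^sup>2 + inner (blinfun_apply K y) y"
    by (simp add: power_mult_distrib)
  moreover have "(1 - 8 * s\<^sup>2) * (norm y)\<^sup>2 \<le> (1 - 4 * s\<^sup>2)\<^sup>2 * (norm y)\<^sup>2"
    using zero_le_power2[of "4 * s\<^sup>2"] by (intro mult_right_mono) (simp_all add: power2_diff)
  \<comment> \<open>The bound is restated with the norm of the unprojected vector, as the numerical
    radius of the compression requires.\<close>
  moreover have "8 * s\<^sup>2 * (norm y)\<^sup>2 \<le> 8 * s\<^sup>2 * (norm x)\<^sup>2"
    unfolding y_def by (intro mult_left_mono power_mono norm_diag_proj_le) auto
  ultimately show ?thesis
    unfolding y_def[symmetric] by (simp add: algebra_simps)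
qed

lemma norm_compression_le:
  assumes K: "K \<in> bounded_ops" "K = adjoint_op K"
    and c: "0 \<le> c"
    and bound: "\<And>x. \<bar>inner (blinfun_apply K (blinfun_apply (diag_proj A) x)) (blinfun_apply (diag_proj A) x)\<bar>
      \<le> c * (norm x)\<^sup>2"
  shows "norm (diag_proj A o\<^sub>L K o\<^sub>L diag_proj A) \<le> c"
proof (rule norm_le_numerical_radius[OF _ _ c])
  have P: "inner (blinfun_apply (diag_proj A) x) y = inner x (blinfun_apply (diag_proj A) y)" for x y
    by (simp add: inner_ell2_def diag_proj_selfadjoint)
  show "inner (blinfun_apply (diag_proj A o\<^sub>L K o\<^sub>L diag_proj A) x) y
      = inner x (blinfun_apply (diag_proj A o\<^sub>L K o\<^sub>L diag_proj A) y)" for x y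
    by (simp add: P inner_selfadjoint(2)[OF K])
  show "\<bar>inner (blinfun_apply (diag_proj A o\<^sub>L K o\<^sub>L diag_proj A) x) x\<bar> \<le> c * (norm x)\<^sup>2" for x
    using bound[of x] by (simp add: P)
qed

section \<open>Transfer of pavability between the two classes\<close>

definition pavable :: "real \<Rightarrow> nat \<Rightarrow> (ell2 \<Rightarrow>\<^sub>L ell2) \<Rightarrow> bool" where
  "pavable \<epsilon> r X \<longleftrightarrow> (\<exists>A. paving r A \<and>
     (\<forall>i\<in>{1..r}. norm (diag_proj (A i) o\<^sub>L X o\<^sub>L diag_proj (A i)) \<le> \<epsilon> * norm X))"

lemma compression_scaleR:
  "diag_proj A o\<^sub>L (c *\<^sub>R X) o\<^sub>L diag_proj A = c *\<^sub>R (diag_proj A o\<^sub>L X o\<^sub>L diag_proj A)"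
  by (rule blinfun_eqI) (simp add: blinfun.scaleR_left blinfun.scaleR_right)

text \<open>Ratio s^2/2 against norm at most 4 yields compressions of size 2 s^2. The resulting 8
  s^2 for the rescaled operator becomes 8 s relative to \<open>H\<close>, and the two triangular
  factors are paved together at the price of squaring \<open>r\<close>.\<close>

lemma selfadjoint_pavable_if_strictly_upper_pavable:
  assumes s: "0 < s" "s \<le> 1/2"
    and upper: "\<And>T. T \<in> strictly_upper \<Longrightarrow> pavable (s\<^sup>2 / 2) r T"
    and H: "H \<in> bounded_ops" "H = adjoint_op H" "\<And>i. entry H i i = 0"
  shows "pavable (8 * s) (r * r) H"
proof -
  \<comment> \<open>For zero \<open>H\<close> the division yields 0, so \<open>K\<close> is 0 and
    all facts about it still hold; that case is separated only when the scaling is undone.\<close>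
  define K where "K = (s / norm H) *\<^sub>R H"
  have K: "K \<in> bounded_ops" "K = adjoint_op K" "entry K i i = 0" for i
    unfolding K_def
    by (rule bounded_ops_scaleR[OF H(1)], rule adjoint_op_scaleR[OF H(1,2)], simp add: entry_scaleR H(3))
  have normK: "norm K \<le> s" using s by (simp add: K_def)
  \<comment> \<open>The negative is written as a real multiple so that the facts on scaling apply; a
    lower bound for its form is an upper bound for that of \<open>K\<close>.\<close>
  define K' where "K' = (-1) *\<^sub>R K"
  have K': "K' \<in> bounded_ops" "K' = adjoint_op K'" "entry K' i i = 0" for i
    unfolding K'_def
    by (rule bounded_ops_scaleR[OF K(1)], rule adjoint_op_scaleR[OF K(1,2)], simp only: entry_scaleR K(3) scaleR_zero_right)
  have normK': "norm K' \<le> s" using normK by (simp add: K'_def)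
  obtain T D where T: "T \<in> strictly_upper" "norm T \<le> 4" and D: "\<And>k. 1 - 2 * s\<^sup>2 \<le> D k" "\<And>k. D k \<le> (2::real)"
    and TD: "\<And>x. (norm (blinfun_apply (T + diag_op (\<lambda>k. complex_of_real (D k))) x))\<^sup>2
          \<le> (norm x)\<^sup>2 + inner (blinfun_apply K x) x"
    using exists_triangular_factor[OF K normK s(2)] by blast
  obtain T' D' where T': "T' \<in> strictly_upper" "norm T' \<le> 4" and D': "\<And>k. 1 - 2 * s\<^sup>2 \<le> D' k" "\<And>k. D' k \<le> (2::real)"
    and TD': "\<And>x. (norm (blinfun_apply (T' + diag_op (\<lambda>k. complex_of_real (D' k))) x))\<^sup>2
          \<le> (norm x)\<^sup>2 + inner (blinfun_apply K' x) x"
    using exists_triangular_factor[OF K' normK' s(2)] by blast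
  obtain A where A: "paving r A"
    "\<forall>i\<in>{1..r}. norm (diag_proj (A i) o\<^sub>L T o\<^sub>L diag_proj (A i)) \<le> s\<^sup>2 / 2 * norm T"
    using upper[OF T(1)] unfolding pavable_def by blast
  obtain B where B: "paving r B"
    "\<forall>i\<in>{1..r}. norm (diag_proj (B i) o\<^sub>L T' o\<^sub>L diag_proj (B i)) \<le> s\<^sup>2 / 2 * norm T'"
    using upper[OF T'(1)] unfolding pavable_def by blast
  obtain C where C: "paving (r * r) C"
    "\<And>i. i \<in> {1..r * r} \<Longrightarrow> norm (diag_proj (C i) o\<^sub>L T o\<^sub>L diag_proj (C i)) \<le> s\<^sup>2 / 2 * norm T"
    "\<And>i. i \<in> {1..r * r} \<Longrightarrow> norm (diag_proj (C i) o\<^sub>L T' o\<^sub>L diag_proj (C i)) \<le> s\<^sup>2 / 2 * norm T'"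
    using common_paving[OF A B] by blast
  have le4: "s\<^sup>2 / 2 * norm X \<le> 2 * s\<^sup>2" if "norm X \<le> 4" for X :: "ell2 \<Rightarrow>\<^sub>L ell2"
    using mult_left_mono[OF that, of "s\<^sup>2 / 2"] by simp
  have "norm (diag_proj (C i) o\<^sub>L H o\<^sub>L diag_proj (C i)) \<le> 8 * s * norm H" if i: "i \<in> {1..r * r}" for i
  proof (cases "H = 0")
    case True
    then have "diag_proj (C i) o\<^sub>L H o\<^sub>L diag_proj (C i) = 0"
      by (intro blinfun_eqI) simp
    then show ?thesis using True by simp
  next
    case False
    have "norm (diag_proj (C i) o\<^sub>L K o\<^sub>L diag_proj (C i)) \<le> 8 * s\<^sup>2"
    proof (rule norm_compression_le[OF K(1,2)])
      fix x
      let ?y = "blinfun_apply (diag_proj (C i)) x"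
      have "- (8 * s\<^sup>2 * (norm x)\<^sup>2) \<le> inner (blinfun_apply K ?y) ?y"
        by (rule inner_compression_ge[OF D TD less_imp_le[OF s(1)] s(2) order_trans[OF C(2)[OF i] le4[OF T(2)]]])
      moreover have "- (8 * s\<^sup>2 * (norm x)\<^sup>2) \<le> inner (blinfun_apply K' ?y) ?y"
        by (rule inner_compression_ge[OF D' TD' less_imp_le[OF s(1)] s(2) order_trans[OF C(3)[OF i] le4[OF T'(2)]]])
      ultimately show "\<bar>inner (blinfun_apply K ?y) ?y\<bar> \<le> 8 * s\<^sup>2 * (norm x)\<^sup>2"
        by (simp add: K'_def blinfun.minus_left)
    qed simp
    then have "s / norm H * norm (diag_proj (C i) o\<^sub>L H o\<^sub>L diag_proj (C i)) \<le> s / norm H * (8 * s * norm H)"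
      using False s(1) by (simp add: K_def compression_scaleR power2_eq_square)
    then show ?thesis
      using False s(1) by (subst (asm) mult_le_cancel_left_pos) auto
  qed
  then show ?thesis using C(1) unfolding pavable_def by blast
qed

text \<open>The parts are left unnormalized: X = T + S and Y = i (T - S), with \<open>S\<close> the
  adjoint of \<open>T\<close>, are self-adjoint with zero diagonal and norm at most twice that of
  \<open>T\<close>. Since 2 T = X - i Y, paving both with ratio \<epsilon> gives 2 \<epsilon> for
  \<open>T\<close>.\<close>

lemma strictly_upper_pavable_if_selfadjoint_pavable:
  assumes selfadjoint: "\<And>H. H \<in> bounded_ops \<Longrightarrow> H = adjoint_op H \<Longrightarrow> \<forall>i. entry H i i = 0 \<Longrightarrow> pavable \<epsilon> r H"
    and \<epsilon>: "0 \<le> \<epsilon>"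
    and T: "T \<in> bounded_ops" "\<And>i. entry T i i = 0"
  shows "pavable (2 * \<epsilon>) (r * r) T"
proof -
  define S where "S = adjoint_op T"
  have S: "S \<in> bounded_ops" "norm S \<le> norm T" "entry S i i = 0" for i
    by (simp_all add: S_def adjoint_op(1) norm_adjoint_op_le entry_adjoint_op T)
  have TS: "cinner (blinfun_apply T x) y = cinner x (blinfun_apply S y)" for x y
    unfolding S_def by (rule adjoint_op(2)[OF T(1)])
  have ST: "cinner (blinfun_apply S x) y = cinner x (blinfun_apply T y)" for x y
    using TS[of y x] by (metis cinner_commute)
  \<comment> \<open>Operators carry only real scalars, so multiplication by the imaginary unit
    enters as a diagonal operator.\<close>
  define J where "J = diag_op (\<lambda>_. \<i>)"
  have J: "blinfun_apply J x = scaleC \<i> x" for x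
    by (rule ell2_eqI) (simp add: J_def coord_diag_op[where K = 1])
  have J_in: "J \<in> bounded_ops"
    unfolding J_def by (rule diag_op_in_bounded_ops[where K = 1]) simp
  define X where "X = T + S"
  define Y where "Y = J o\<^sub>L (T - S)"
  have X: "X \<in> bounded_ops" "entry X i i = 0" "norm X \<le> 2 * norm T" for i
    using norm_triangle_ineq[of T S] S(2)
    by (simp_all add: X_def bounded_ops_add T S(1)) (use T S(3) in \<open>simp add: entry_def blinfun.add_left\<close>)
  have X_adj: "X = adjoint_op X"
    by (rule adjoint_op_eqI[OF X(1), symmetric]) (simp add: X_def blinfun.add_left cinner_add TS ST)
  have Y: "Y \<in> bounded_ops" "entry Y i i = 0" for i
    using T S(3)
    by (simp_all add: Y_def bounded_ops_compose bounded_ops_diff J_in S(1) entry_def J blinfun.diff_left)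
  have normY: "norm Y \<le> 2 * norm T"
  proof (rule norm_blinfun_bound)
    fix x
    have "norm (blinfun_apply Y x) = norm (blinfun_apply (T - S) x)"
      by (simp add: Y_def J)
    also have "\<dots> \<le> norm (T - S) * norm x" by (rule norm_blinfun)
    also have "\<dots> \<le> 2 * norm T * norm x"
      using norm_triangle_ineq4[of T S] S(2) by (intro mult_right_mono) auto
    finally show "norm (blinfun_apply Y x) \<le> 2 * norm T * norm x" .
  qed simp
  have Y_adj: "Y = adjoint_op Y"
    by (rule adjoint_op_eqI[OF Y(1), symmetric])
      (simp add: Y_def J blinfun.diff_left cinner_diff cinner_scaleC TS ST algebra_simps)
  obtain A where A: "paving r A"
    "\<forall>i\<in>{1..r}. norm (diag_proj (A i) o\<^sub>L X o\<^sub>L diag_proj (A i)) \<le> \<epsilon> * norm X"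
    using selfadjoint[OF X(1) X_adj] X(2) unfolding pavable_def by blast
  obtain B where B: "paving r B"
    "\<forall>i\<in>{1..r}. norm (diag_proj (B i) o\<^sub>L Y o\<^sub>L diag_proj (B i)) \<le> \<epsilon> * norm Y"
    using selfadjoint[OF Y(1) Y_adj] Y(2) unfolding pavable_def by blast
  obtain C where C: "paving (r * r) C"
    "\<And>i. i \<in> {1..r * r} \<Longrightarrow> norm (diag_proj (C i) o\<^sub>L X o\<^sub>L diag_proj (C i)) \<le> \<epsilon> * norm X"
    "\<And>i. i \<in> {1..r * r} \<Longrightarrow> norm (diag_proj (C i) o\<^sub>L Y o\<^sub>L diag_proj (C i)) \<le> \<epsilon> * norm Y"
    using common_paving[OF A B] by blast
  have "norm (diag_proj (C i) o\<^sub>L T o\<^sub>L diag_proj (C i)) \<le> 2 * \<epsilon> * norm T" if i: "i \<in> {1..r * r}" for i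
  proof (rule norm_blinfun_bound)
    fix x
    let ?x = "blinfun_apply (diag_proj (C i) o\<^sub>L X o\<^sub>L diag_proj (C i)) x"
    let ?y = "blinfun_apply (diag_proj (C i) o\<^sub>L Y o\<^sub>L diag_proj (C i)) x"
    let ?t = "blinfun_apply (diag_proj (C i) o\<^sub>L T o\<^sub>L diag_proj (C i)) x"
    have "2 *\<^sub>R ?t = ?x - scaleC \<i> ?y"
      by (rule ell2_eqI)
        (simp add: X_def Y_def J blinfun.add_left blinfun.diff_left coord_diag_proj algebra_simps scaleR_conv_of_real)
    then have "2 * norm ?t = norm (?x - scaleC \<i> ?y)"
      by (metis norm_scaleR abs_numeral)
    also have "\<dots> \<le> norm ?x + norm ?y"
      using norm_triangle_ineq4[of ?x "scaleC \<i> ?y"] by simp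
    also have "norm ?x \<le> \<epsilon> * (2 * norm T) * norm x"
      by (rule order_trans[OF norm_blinfun], rule mult_right_mono,
          rule order_trans[OF C(2)[OF i]], rule mult_left_mono[OF X(3) \<epsilon>]) simp
    also have "norm ?y \<le> \<epsilon> * (2 * norm T) * norm x"
      by (rule order_trans[OF norm_blinfun], rule mult_right_mono,
          rule order_trans[OF C(3)[OF i]], rule mult_left_mono[OF normY \<epsilon>]) simp
    finally show "norm ?t \<le> 2 * \<epsilon> * norm T * norm x" by (simp add: mult_ac)
  qed (use \<epsilon> in simp)
  then show ?thesis using C(1) unfolding pavable_def by blast
qed

lemma pavable_mono: "pavable \<epsilon> r X \<Longrightarrow> \<epsilon> \<le> \<epsilon>' \<Longrightarrow> pavable \<epsilon>' r X"
  unfolding pavable_def by (meson mult_right_mono norm_ge_zero order_trans)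

theorem corollary2p13:
  shows "(\<forall>\<epsilon>::real>0. \<exists>r\<^sub>1. \<forall>H\<in>bounded_ops. H = adjoint_op H \<and> diag_expectation H = 0 \<longrightarrow>
            (\<exists>A. paving r\<^sub>1 A \<and>
              (\<forall>i\<in>{1..r\<^sub>1}. norm (diag_proj (A i) o\<^sub>L H o\<^sub>L diag_proj (A i)) \<le> \<epsilon> * norm H)))
     \<longleftrightarrow>
         (\<forall>\<epsilon>::real>0. \<exists>r\<^sub>2. \<forall>T\<in>strictly_upper.
            (\<exists>A. paving r\<^sub>2 A \<and>
              (\<forall>i\<in>{1..r\<^sub>2}. norm (diag_proj (A i) o\<^sub>L T o\<^sub>L diag_proj (A i)) \<le> \<epsilon> * norm T)))"
  unfolding pavable_def[symmetric] diag_expectation_eq_0_iff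
proof (intro iffI allI impI)
  fix \<epsilon> :: real
  assume *: "\<forall>\<epsilon>::real>0. \<exists>r. \<forall>H\<in>bounded_ops. H = adjoint_op H \<and> (\<forall>i. entry H i i = 0) \<longrightarrow> pavable \<epsilon> r H"
    and \<epsilon>: "0 < \<epsilon>"
  obtain r where r: "\<forall>H\<in>bounded_ops. H = adjoint_op H \<and> (\<forall>i. entry H i i = 0) \<longrightarrow> pavable (\<epsilon> / 2) r H"
    \<comment> \<open>Half of \<epsilon>, because the errors of the two self-adjoint parts add
      up.\<close>
    using * half_gt_zero[OF \<epsilon>] by blast
  have "pavable (2 * (\<epsilon> / 2)) (r * r) T" if "T \<in> strictly_upper" for T
    by (rule strictly_upper_pavable_if_selfadjoint_pavable)
      (use r \<epsilon> that in \<open>auto simp: strictly_upper_def\<close>)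
  then show "\<exists>r. \<forall>T\<in>strictly_upper. pavable \<epsilon> r T" by auto
next
  fix \<epsilon> :: real
  assume *: "\<forall>\<epsilon>::real>0. \<exists>r. \<forall>T\<in>strictly_upper. pavable \<epsilon> r T" and \<epsilon>: "0 < \<epsilon>"
  \<comment> \<open>The cap 1/2 keeps the perturbed identity positive definite; \<epsilon>/8
    compensates the factor 8 in the resulting ratio.\<close>
  define s where "s = min (1/2) (\<epsilon> / 8)"
  have s: "0 < s" "s \<le> 1/2" "8 * s \<le> \<epsilon>" using \<epsilon> by (auto simp: s_def)
  then have "0 < s\<^sup>2 / 2" by simp
  then obtain r where r: "\<forall>T\<in>strictly_upper. pavable (s\<^sup>2 / 2) r T"
    using * by blast
  have "pavable \<epsilon> (r * r) H"
    if "H \<in> bounded_ops" "H = adjoint_op H" "\<forall>i. entry H i i = 0" for H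
    by (rule pavable_mono[OF selfadjoint_pavable_if_strictly_upper_pavable[OF s(1,2) _ that(1,2)] s(3)])
      (use r that(3) in auto)
  then show "\<exists>r. \<forall>H\<in>bounded_ops. H = adjoint_op H \<and> (\<forall>i. entry H i i = 0) \<longrightarrow> pavable \<epsilon> r H"
    by blast
qed

end
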